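(* Let $R=(r,H,N)$ be a state in the grand-potential resource theory defined by $(\beta,\mu)$, with associated equilibrium state $G_R=(g_R,H,N)$. The inverse of the function $\epsilon\mapsto b_\epsilon(r\|g_R)$ is the piecewise linear function that connects the points $(t_k,\,1-L_R(t_k))$, where $t_k$ and $L_R(t_k)$ define the rescaled Lorenz curve for $R$. That is, $(t_k,\,1-L_R(t_k))=(b_\epsilon(r\|g_R),\,\epsilon)$.
   Context: Fix real numbers $\beta,\mu$. A state is $R=(r,H,N)$, where $H$ and $N$ are commuting Hermitian operators on a $d_R$-dimensional Hilbert space and $r$ is a probability vector: the vector of eigenvalues, in a common eigenbasis of $H,N$, of a density operator commuting with $H$ and $N$. The associated equilibrium state $G_R=(g_R,H,N)$ has state vector $g_R$ with entries $g_i=e^{-\beta(E_i-\mu n_i)}/Z$, with $E_i,n_i$ the eigenvalues of $H,N$ on the $i$th common eigenvector and $Z=\sum_ie^{-\beta(E_i-\mu n_i)}$. Rescaled Lorenz curve: $L_R:[0,1]\to[0,1]$ is the piecewise linear function connecting the points $(t_k,L_R(t_k))$, $k=0,\dots,d_R$, with $(t_0,L_R(t_0))=(0,0)$ and $(t_k,L_R(t_k))=\left(\sum_{j=1}^kg_{\pi(j)},\sum_{j=1}^kr_{\pi(j)}\right)$ for $k\ge1$, where $\pi$ is a permutation such that $(r_{\pi(j)}/g_{\pi(j)})_j$ is nonincreasing. Optimal Type II error probability: for $\epsilon\in[0,1]$, $b_\epsilon(\rho\|\sigma)=\min\{\mathrm{Tr}[Q\sigma]:0\le Q\le\mathbb 1,\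 \mathrm{Tr}[Q\rho]\ge1-\epsilon\}$; probability vectors are identified with diagonal density matrices.
   Formalization: If r has zero entries, b_ε only takes values in [0,s], s = b_0 = total g-weight of the support of r; so the inverse is identified on [0,s] only (the piecewise linear function is 0 on [s,1]) and the point identity is for t_k ≤ s. For r without zeros s = 1, and the claim holds as written. *)

theory Defs
  imports "HOL-Analysis.Analysis"
begin

definition cinner :: "complex ^ 'd \<Rightarrow> complex ^ 'd \<Rightarrow> complex" where
  "cinner x y = (\<Sum>i\<in>UNIV. cnj (x $ i) * y $ i)"

definition hermitian :: "complex ^ 'd ^ 'd \<Rightarrow> bool" where
  "hermitian A \<longleftrightarrow> (\<forall>i j. A $ i $ j = cnj (A $ j $ i))"

definition psd :: "complex ^ 'd ^ 'd \<Rightarrow> bool" where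
  "psd A \<longleftrightarrow> hermitian A \<and> (\<forall>x. 0 \<le> Re (cinner x (A *v x)))"

definition loewner_le :: "complex ^ 'd ^ 'd \<Rightarrow> complex ^ 'd ^ 'd \<Rightarrow> bool" where
  "loewner_le A B \<longleftrightarrow> psd (B - A)"

definition density_operator :: "complex ^ 'd ^ 'd \<Rightarrow> bool" where
  "density_operator \<rho> \<longleftrightarrow> psd \<rho> \<and> trace \<rho> = 1"

definition prob_vector :: "real ^ 'd \<Rightarrow> bool" where
  "prob_vector p \<longleftrightarrow> (\<forall>i. 0 \<le> p $ i) \<and> (\<Sum>i\<in>UNIV. p $ i) = 1"

definition diag_density :: "real ^ 'd \<Rightarrow> complex ^ 'd ^ 'd" where
  "diag_density p = (\<chi> i j. if i = j then complex_of_real (p $ i) else 0)"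

definition orthonormal_basis :: "('d \<Rightarrow> complex ^ 'd) \<Rightarrow> bool" where
  "orthonormal_basis e \<longleftrightarrow> (\<forall>i j. cinner (e i) (e j) = (if i = j then 1 else 0))"

definition eigenbasis ::
    "complex ^ 'd ^ 'd \<Rightarrow> ('d \<Rightarrow> complex ^ 'd) \<Rightarrow> real ^ 'd \<Rightarrow> bool" where
  "eigenbasis A e a \<longleftrightarrow>
     orthonormal_basis e \<and> (\<forall>i. A *v e i = complex_of_real (a $ i) *s e i)"

text \<open>
  A state \<open>(r, H, N)\<close>. Its entries are labelled by a common eigenbasis \<open>e\<close> of \<open>H\<close> and \<open>N\<close>;
  \<open>E $ i\<close>, \<open>n $ i\<close> and \<open>r $ i\<close> are the eigenvalues of \<open>H\<close>, \<open>N\<close> and of the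
  density operator on the same vector \<open>e i\<close>.
\<close>
definition gp_state ::
    "real ^ 'd \<Rightarrow> complex ^ 'd ^ 'd \<Rightarrow> complex ^ 'd ^ 'd \<Rightarrow>
     ('d \<Rightarrow> complex ^ 'd) \<Rightarrow> real ^ 'd \<Rightarrow> real ^ 'd \<Rightarrow> bool" where
  "gp_state r H N e E n \<longleftrightarrow>
     hermitian H \<and> hermitian N \<and> H ** N = N ** H \<and>
     eigenbasis H e E \<and> eigenbasis N e n \<and>
     prob_vector r \<and>
     (\<exists>\<rho>. density_operator \<rho> \<and> \<rho> ** H = H ** \<rho> \<and> \<rho> ** N = N ** \<rho> \<and> eigenbasis \<rho> e r)"

definition partition_function :: "real \<Rightarrow> real \<Rightarrow> real ^ 'd \<Rightarrow> real ^ 'd \<Rightarrow> real" where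
  "partition_function \<beta> \<mu> E n = (\<Sum>i\<in>UNIV. exp (- \<beta> * (E $ i - \<mu> * n $ i)))"

definition equilibrium_vector :: "real \<Rightarrow> real \<Rightarrow> real ^ 'd \<Rightarrow> real ^ 'd \<Rightarrow> real ^ 'd" where
  "equilibrium_vector \<beta> \<mu> E n =
     (\<chi> i. exp (- \<beta> * (E $ i - \<mu> * n $ i)) / partition_function \<beta> \<mu> E n)"

text \<open>
  The basis labels form an arbitrary finite type, so the reordering permutation becomes an
  enumeration of that type by \<open>1, \<dots>, d\<close>.
\<close>
definition rescaled_order :: "real ^ 'd \<Rightarrow> real ^ 'd \<Rightarrow> (nat \<Rightarrow> 'd) \<Rightarrow> bool" where
  "rescaled_order r g \<pi> \<longleftrightarrow>
     bij_betw \<pi> {1..CARD('d)} UNIV \<and>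
     antimono_on {1..CARD('d)} (\<lambda>j. r $ \<pi> j / g $ \<pi> j)"

definition partial_sum :: "real ^ 'd \<Rightarrow> (nat \<Rightarrow> 'd) \<Rightarrow> nat \<Rightarrow> real" where
  "partial_sum p \<pi> k = (\<Sum>j=1..k. p $ \<pi> j)"

text \<open>
  The piecewise linear function connecting \<open>(x 0, y 0), \<dots>, (x m, y m)\<close>, for strictly increasing
  \<open>x 0 < \<dots> < x m\<close>. It is meaningful only on \<open>{x 0..x m}\<close>.
\<close>
definition piecewise_linear ::
    "(nat \<Rightarrow> real) \<Rightarrow> (nat \<Rightarrow> real) \<Rightarrow> nat \<Rightarrow> real \<Rightarrow> real" where
  "piecewise_linear x y m s =
     (let k = (LEAST k. k \<in> {1..m} \<and> s \<le> x k)
      in y (k - 1) + (y k - y (k - 1)) * ((s - x (k - 1)) / (x k - x (k - 1))))"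

definition lorenz_curve ::
    "real ^ 'd \<Rightarrow> real ^ 'd \<Rightarrow> (nat \<Rightarrow> 'd) \<Rightarrow> real \<Rightarrow> real" where
  "lorenz_curve r g \<pi> =
     piecewise_linear (partial_sum g \<pi>) (partial_sum r \<pi>) CARD('d)"

text \<open>
  Traces of products of two positive semidefinite matrices are real, so \<open>Re\<close> loses nothing.
  \<open>Least\<close> is the minimum of the set of attained values, not merely its infimum.
\<close>
definition type_II_error :: "real \<Rightarrow> complex ^ 'd ^ 'd \<Rightarrow> complex ^ 'd ^ 'd \<Rightarrow> real" where
  "type_II_error \<epsilon> \<rho> \<sigma> =
     (LEAST x. \<exists>Q. loewner_le 0 Q \<and> loewner_le Q (mat 1) \<and>
        1 - \<epsilon> \<le> Re (trace (Q ** \<rho>)) \<and> x = Re (trace (Q ** \<sigma>)))"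

end

theory Submission
  imports Defs
begin

text \<open>
  Only the diagonal of a test \<open>Q\<close> enters the two traces, so a test amounts to a vector \<open>q\<close> in
  the unit cube. Among all \<open>q\<close> with \<open>q \<bullet> g = x\<close> the largest value of \<open>q \<bullet> r\<close> is \<open>L x\<close>
  (Neyman--Pearson: fill up the labels in order of decreasing \<open>r/g\<close>). As a maximum over a convex
  set, \<open>L\<close> is concave, and it reaches the value 1 exactly from \<open>s\<close> on. Hence \<open>L\<close> is strictly
  increasing on \<open>{0..s}\<close>, and there \<open>b\<^bsub>1 - L x\<^esub> = x\<close>.
\<close>

section \<open>Piecewise linear functions\<close>

text \<open>\<open>LEAST\<close> selects the first segment reaching up to \<open>s\<close>. At a
  breakpoint this may be the segment before \<open>k\<close>, but both formulas give the same value
  there.\<close>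

lemma piecewise_linear_segment:
  assumes x: "strict_mono_on {0..m} x" and k: "k \<in> {1..m}" and s: "x (k - 1) \<le> s" "s \<le> x k"
  shows "piecewise_linear x y m s =
    y (k - 1) + (y k - y (k - 1)) * ((s - x (k - 1)) / (x k - x (k - 1)))"
proof -
  define j where "j = (LEAST k. k \<in> {1..m} \<and> s \<le> x k)"
  have j: "j \<in> {1..m} \<and> s \<le> x j"
    unfolding j_def by (rule LeastI[of _ k]) (use k s in auto)
  have "j \<le> k"
    unfolding j_def by (rule Least_le) (use k s in auto)
  have pl: "piecewise_linear x y m s =
      y (j - 1) + (y j - y (j - 1)) * ((s - x (j - 1)) / (x j - x (j - 1)))"
    by (simp add: piecewise_linear_def j_def Let_def)
  show ?thesis
  proof (cases "j = k")
    case True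
    then show ?thesis using pl by simp
  next
    case False
    with \<open>j \<le> k\<close> have "j \<le> k - 1" by simp
    have "k - 1 \<le> j"
    proof (rule ccontr)
      assume "\<not> k - 1 \<le> j"
      then have "x j < x (k - 1)"
        using j k by (intro strict_mono_onD[OF x]) auto
      then show False using j s by simp
    qed
    with \<open>j \<le> k - 1\<close> have jk: "k - 1 = j" by simp
    have "x (j - 1) < x j" using j by (intro strict_mono_onD[OF x]) auto
    moreover have "s = x j" using s j jk by simp
    ultimately show ?thesis using pl jk by simp
  qed
qed

text \<open>The first breakpoint at or above \<open>s\<close> closes the segment. This serves both
  \<open>t\<close> and \<open>R\<close>, where \<open>R\<close> may repeat values.\<close>

lemma ex_segment:
  fixes x :: "nat \<Rightarrow> real"
  assumes "0 < m" "x 0 \<le> s" "s \<le> x m"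
  obtains k where "k \<in> {1..m}" "x (k - 1) \<le> s" "s \<le> x k"
proof -
  define k where "k = (LEAST k. k \<in> {1..m} \<and> s \<le> x k)"
  have k: "k \<in> {1..m} \<and> s \<le> x k"
    unfolding k_def by (rule LeastI[of _ m]) (use assms in auto)
  have "x (k - 1) \<le> s"
  proof (cases "k = 1")
    case False
    then have "k - 1 < k" "k - 1 \<in> {1..m}" using k by auto
    then show ?thesis using not_less_Least[of "k - 1"] unfolding k_def by fastforce
  qed (use assms in simp)
  with k that show ?thesis by blast
qed

section \<open>The Lorenz curve as a maximum over tests\<close>

locale lorenz =
  fixes r g :: "real ^ 'd" and \<pi> :: "nat \<Rightarrow> 'd"
  assumes r: "prob_vector r" and g: "prob_vector g" and g_pos: "\<And>i. 0 < g $ i"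
    and order: "rescaled_order r g \<pi>"
begin

abbreviation "t \<equiv> partial_sum g \<pi>"
abbreviation "R \<equiv> partial_sum r \<pi>"
abbreviation "L \<equiv> lorenz_curve r g \<pi>"
abbreviation "slope k \<equiv> r $ \<pi> k / g $ \<pi> k"
text \<open>The equilibrium weight of the support of \<open>r\<close>, which turns out to be the
  first point where \<open>L\<close> equals 1.\<close>

abbreviation "s \<equiv> (\<Sum>i | r $ i \<noteq> 0. g $ i)"

section \<open>Breakpoints and segments of the curve\<close>

lemma bij: "bij_betw \<pi> {1..CARD('d)} UNIV"
  using order by (simp add: rescaled_order_def)

lemma slope_antimono: "i \<in> {1..CARD('d)} \<Longrightarrow> j \<in> {1..CARD('d)} \<Longrightarrow> i \<le> j \<Longrightarrow> slope j \<le> slope i"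
  using order by (auto simp: rescaled_order_def monotone_on_def)

lemma inner_eq_sum: "p \<bullet> q = (\<Sum>j\<in>{1..CARD('d)}. p $ \<pi> j * q $ \<pi> j)" for p q :: "real ^ 'd"
  unfolding inner_vec_def by (simp add: sum.reindex_bij_betw[OF bij, symmetric])

lemma r_nonneg: "0 \<le> r $ i" and sum_r: "1 \<bullet> r = 1" and sum_g: "1 \<bullet> g = 1"
  using r g by (auto simp: prob_vector_def inner_vec_def)

lemma partial_sum_step: "k \<in> {1..CARD('d)} \<Longrightarrow> partial_sum p \<pi> k = partial_sum p \<pi> (k - 1) + p $ \<pi> k"
  by (cases k) (auto simp: partial_sum_def)

lemma partial_sum_0: "partial_sum p \<pi> 0 = 0"
  by (simp add: partial_sum_def)

lemma partial_sum_card: "partial_sum p \<pi> CARD('d) = 1 \<bullet> p"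
  by (simp add: partial_sum_def inner_eq_sum)

lemma t_strict_mono: "strict_mono_on {0..CARD('d)} t"
proof (rule strict_mono_onI)
  fix i j assume "i \<in> {0..CARD('d)}" "j \<in> {0..CARD('d)}" "i < j"
  then show "t i < t j"
    unfolding partial_sum_def by (intro sum_strict_mono2[where b = j]) (auto intro: less_imp_le g_pos)
qed

lemma t_mono: "i \<le> j \<Longrightarrow> j \<le> CARD('d) \<Longrightarrow> t i \<le> t j"
  using strict_mono_onD[OF t_strict_mono, of i j] by (cases "i = j") auto

lemma L_segment:
  assumes "k \<in> {1..CARD('d)}" "t (k - 1) \<le> x" "x \<le> t k"
  shows "L x = R (k - 1) + slope k * (x - t (k - 1))"
  using assms piecewise_linear_segment[OF t_strict_mono assms, of R]
  by (simp add: lorenz_curve_def partial_sum_step)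

lemma ex_t_segment:
  assumes "x \<in> {0..1}"
  obtains k where "k \<in> {1..CARD('d)}" "t (k - 1) \<le> x" "x \<le> t k"
  using ex_segment[of "CARD('d)" t x] assms by (auto simp: partial_sum_0 partial_sum_card sum_g)

lemma L_t:
  assumes "k \<le> CARD('d)" shows "L (t k) = R k"
proof (cases "k = 0")
  case True
  then show ?thesis
    using L_segment[of 1 "t 0"] t_mono[of 0 1] by simp
next
  case False
  then have "k \<in> {1..CARD('d)}" using assms by simp
  then show ?thesis
    using L_segment[of k "t k"] t_mono[of "k - 1" k] g_pos[of "\<pi> k"]
    by (simp add: partial_sum_step)
qed

text \<open>Both functions are affine on each segment of \<open>t\<close> and agree at its
  ends.\<close>

lemma piecewise_linear_complement:
  assumes "x \<in> {0..1}"
  shows "piecewise_linear t (\<lambda>k. 1 - L (t k)) CARD('d) x = 1 - L x"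
proof -
  obtain k where k: "k \<in> {1..CARD('d)}" "t (k - 1) \<le> x" "x \<le> t k"
    using ex_t_segment[OF assms] .
  then have L_k: "L (t (k - 1)) = R (k - 1)" "L (t k) = R (k - 1) + r $ \<pi> k"
    using L_t[of "k - 1"] L_t[of k] partial_sum_step[OF k(1), of r] by auto
  show ?thesis
    unfolding piecewise_linear_segment[OF t_strict_mono k] L_segment[OF k] L_k
    by (simp add: partial_sum_step[OF k(1)])
qed

section \<open>Tests in the unit cube\<close>

lemma inner_in_unit:
  assumes "q \<in> cbox 0 1" "prob_vector p"
  shows "q \<bullet> p \<in> {0..1}"
proof -
  have "q \<bullet> p \<le> (\<Sum>i\<in>UNIV. p $ i)"
    unfolding inner_vec_def using assms
    by (intro sum_mono) (auto simp: mem_box_cart prob_vector_def intro: mult_left_le_one_le)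
  moreover have "0 \<le> q \<bullet> p"
    unfolding inner_vec_def using assms
    by (intro sum_nonneg) (auto simp: mem_box_cart prob_vector_def)
  ultimately show ?thesis using assms by (simp add: prob_vector_def)
qed

text \<open>On the segment \<open>k\<close>, the curve is the line with slope \<open>c\<close>; the inequality compares
  \<open>q \<bullet> (r - c g)\<close> with the sum of the nonnegative entries of \<open>r - c g\<close>.\<close>
lemma inner_le_L:
  assumes q: "q \<in> cbox 0 1"
  shows "q \<bullet> r \<le> L (q \<bullet> g)"
proof -
  obtain k where k: "k \<in> {1..CARD('d)}" "t (k - 1) \<le> q \<bullet> g" "q \<bullet> g \<le> t k"
    using ex_t_segment[OF inner_in_unit[OF q g]] .
  define c where "c = slope k"
  define f where "f i = r $ i - c * g $ i" for i
  have f_nonneg: "0 \<le> f (\<pi> j)" if "j \<in> {1..k}" for j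
    using slope_antimono[of j k] that k g_pos[of "\<pi> j"] by (simp add: f_def c_def pos_le_divide_eq)
  have f_nonpos: "f (\<pi> j) \<le> 0" if "j \<in> {1..CARD('d)}" "k < j" for j
    using slope_antimono[of k j] that k g_pos[of "\<pi> j"] by (simp add: f_def c_def pos_divide_le_eq)
  have q01: "0 \<le> q $ i" "q $ i \<le> 1" for i using q by (auto simp: mem_box_cart)
  have "q \<bullet> r - c * (q \<bullet> g) = (\<Sum>j\<in>{1..CARD('d)}. q $ \<pi> j * f (\<pi> j))"
    by (simp add: inner_eq_sum f_def algebra_simps sum_subtractf sum_distrib_left)
  also have "\<dots> \<le> (\<Sum>j\<in>{1..CARD('d)}. if j \<in> {1..k} then f (\<pi> j) else 0)"
    using f_nonneg f_nonpos q01
    by (intro sum_mono) (auto intro: mult_left_le_one_le mult_nonneg_nonpos)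
  also have "\<dots> = (\<Sum>j\<in>{1..k}. f (\<pi> j))"
    using k by (subst sum.inter_restrict[symmetric]) (auto intro: sum.cong)
  also have "\<dots> = R k - c * t k"
    by (simp add: f_def partial_sum_def sum_subtractf sum_distrib_left)
  \<comment> \<open>By the choice of \<open>c\<close>, \<open>f (\<pi> k) = 0\<close>, so the last
    terms cancel.\<close>
  also have "\<dots> = R (k - 1) - c * t (k - 1)"
    using g_pos[of "\<pi> k"] by (simp add: partial_sum_step[OF k(1)] c_def field_simps)
  finally show ?thesis
    using L_segment[OF k] by (simp add: c_def algebra_simps)
qed

text \<open>The greedy test accepts the first \<open>k - 1\<close> labels fully and label
  \<open>\<pi> k\<close> with the fraction \<open>w\<close> that uses up the remaining
  weight.\<close>

lemma L_attained:
  assumes x: "x \<in> {0..1}"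
  obtains q where "q \<in> cbox 0 1" "q \<bullet> g = x" "q \<bullet> r = L x"
proof -
  obtain k where k: "k \<in> {1..CARD('d)}" "t (k - 1) \<le> x" "x \<le> t k"
    using ex_t_segment[OF x] .
  define w where "w = (x - t (k - 1)) / g $ \<pi> k"
  define a where "a j = (if j < k then 1 else if j = k then w else 0)" for j :: nat
  \<comment> \<open>The coefficients \<open>a\<close> are indexed by positions; the inverse of
    \<open>\<pi>\<close> carries them to labels.\<close>
  define q :: "real ^ 'd" where "q = (\<chi> i. a (the_inv_into {1..CARD('d)} \<pi> i))"
  have w: "0 \<le> w" "w \<le> 1"
    using k g_pos[of "\<pi> k"] partial_sum_step[OF k(1), of g] by (auto simp: w_def)
  have q\<pi>: "q $ \<pi> j = a j" if "j \<in> {1..CARD('d)}" for j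
    using that bij by (simp add: q_def the_inv_into_f_f bij_betw_def)
  have inner_q: "q \<bullet> p = partial_sum p \<pi> (k - 1) + w * p $ \<pi> k" for p
  proof -
    have "q \<bullet> p = (\<Sum>j\<in>{1..CARD('d)}. a j * p $ \<pi> j)"
      by (simp add: inner_eq_sum q\<pi>)
    also have "\<dots> = (\<Sum>j\<in>{1..k}. a j * p $ \<pi> j)"
      using k by (intro sum.mono_neutral_right) (auto simp: a_def)
    also have "\<dots> = (\<Sum>j\<in>{1..k - 1}. a j * p $ \<pi> j) + a k * p $ \<pi> k"
      using k by (cases k) auto
    also have "(\<Sum>j\<in>{1..k - 1}. a j * p $ \<pi> j) = partial_sum p \<pi> (k - 1)"
      unfolding partial_sum_def by (intro sum.cong) (auto simp: a_def)
    finally show ?thesis by (simp add: a_def)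
  qed
  show ?thesis
  proof
    show "q \<in> cbox 0 1" using w by (auto simp: mem_box_cart q_def a_def)
    show "q \<bullet> g = x" using g_pos[of "\<pi> k"] by (simp add: inner_q w_def)
    show "q \<bullet> r = L x" by (simp add: inner_q w_def L_segment[OF k] field_simps)
  qed
qed

section \<open>Concavity, saturation at \<open>s\<close> and invertibility of the curve\<close>

lemma L_in_unit: "x \<in> {0..1} \<Longrightarrow> L x \<in> {0..1}"
  by (metis L_attained inner_in_unit r)

text \<open>A convex mixture of optimal tests is again a test, and \<open>inner_le_L\<close> bounds
  its value.\<close>

lemma L_concave: "concave_on {0..1} L"
proof (rule concave_on_linorderI)
  fix u x y :: real
  assume u: "0 < u" "u < 1" and x: "x \<in> {0..1}" and y: "y \<in> {0..1}"
  obtain p where p: "p \<in> cbox 0 1" "p \<bullet> g = x" "p \<bullet> r = L x" using L_attained[OF x] .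
  obtain q where q: "q \<in> cbox 0 1" "q \<bullet> g = y" "q \<bullet> r = L y" using L_attained[OF y] .
  have "(1 - u) *\<^sub>R p + u *\<^sub>R q \<in> cbox 0 1"
    using p q u by (intro convexD[OF convex_box(1)]) auto
  from inner_le_L[OF this] show "(1 - u) * L x + u * L y \<le> L ((1 - u) *\<^sub>R x + u *\<^sub>R y)"
    by (simp add: inner_add_left p q)
qed (rule convex_real_interval)

text \<open>The indicator of the support of \<open>r\<close> is a test of weight \<open>s\<close>
  that collects all of \<open>r\<close>.\<close>

lemma L_s: "s \<in> {0..1}" "L s = 1"
proof -
  define q :: "real ^ 'd" where "q = (\<chi> i. if r $ i \<noteq> 0 then 1 else 0)"
  have q: "q \<in> cbox 0 1" by (simp add: q_def mem_box_cart)
  have "q \<bullet> g = s"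
    unfolding inner_vec_def by (intro sum.mono_neutral_cong_right) (auto simp: q_def)
  moreover have "q \<bullet> r = 1 \<bullet> r"
    unfolding inner_vec_def by (intro sum.cong) (auto simp: q_def)
  ultimately show s: "s \<in> {0..1}" and "L s = 1"
    using inner_in_unit[OF q g] inner_le_L[OF q] sum_r L_in_unit[of s] by auto
qed

text \<open>A test that collects all of \<open>r\<close> must be 1 on the support of
  \<open>r\<close>, which already costs the weight \<open>s\<close>.\<close>

lemma s_le_of_L_eq_1:
  assumes "x \<in> {0..1}" "L x = 1" shows "s \<le> x"
proof -
  obtain q where q: "q \<in> cbox 0 1" "q \<bullet> g = x" "q \<bullet> r = L x" using L_attained[OF assms(1)] .
  have q01: "0 \<le> q $ i" "q $ i \<le> 1" for i using q by (auto simp: mem_box_cart)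
  have "(\<Sum>i\<in>UNIV. (1 - q $ i) * r $ i) = 0"
    using q sum_r assms by (simp add: inner_vec_def algebra_simps sum_subtractf)
  then have "(1 - q $ i) * r $ i = 0" for i
    using q01 r_nonneg by (subst (asm) sum_nonneg_eq_0_iff) auto
  then have "s = (\<Sum>i | r $ i \<noteq> 0. q $ i * g $ i)"
    by (intro sum.cong) auto
  also have "\<dots> \<le> q \<bullet> g"
    unfolding inner_vec_def inner_real_def
    by (intro sum_mono2) (auto simp: q01 g_pos less_imp_le)
  finally show ?thesis using q by simp
qed

lemma L_eq_1:
  assumes "x \<in> {s..1}" shows "L x = 1"
proof -
  have L1: "L 1 = 1"
    using L_t[of "CARD('d)"] by (simp add: partial_sum_card sum_r sum_g)
  show ?thesis
  \<comment> \<open>For \<open>s < 1\<close>, concavity applies to the chord from \<open>s\<close>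
    to 1, at both ends of which \<open>L\<close> is 1. Otherwise the interval is a single
    point.\<close>
  proof (cases "s < 1")
    case True
    define u where "u = (x - s) / (1 - s)"
    have "u * (1 - s) = x - s"
      using True by (simp add: u_def)
    then have x: "x = (1 - u) * s + u * 1"
      by (simp add: algebra_simps)
    have "0 \<le> u" "u \<le> 1"
      using assms True by (auto simp: u_def)
    then have "(1 - u) * L s + u * L 1 \<le> L x"
      using concave_onD[OF L_concave, of u s 1] L_s x by simp
    then have "1 \<le> L x" by (simp add: L_s L1)
    then show ?thesis using L_in_unit[of x] assms L_s by auto
  next
    case False
    then have "x = 1" using assms by auto
    then show ?thesis using L1 by simp
  qed
qed

text \<open>Left of \<open>s\<close> the value is below 1, so the chord from \<open>x\<close> to
  \<open>s\<close> rises strictly; by concavity \<open>L\<close> lies on or above it.\<close>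

lemma L_strict_mono: "strict_mono_on {0..s} L"
proof (rule strict_mono_onI)
  fix x y assume *: "x \<in> {0..s}" "y \<in> {0..s}" "x < y"
  \<comment> \<open>The relative position of \<open>y\<close> between \<open>x\<close> and
    \<open>s\<close>.\<close>
  define u where "u = (y - x) / (s - x)"
  have u: "0 < u" "u \<le> 1"
    using * by (auto simp: u_def)
  have "u * (s - x) = y - x"
    using * by (simp add: u_def)
  then have y: "y = (1 - u) * x + u * s"
    by (simp add: algebra_simps)
  have x: "x \<in> {0..1}" using * L_s by auto
  have "L x < 1"
    using s_le_of_L_eq_1[OF x] L_in_unit[OF x] * by force
  then have "L x < (1 - u) * L x + u * L s"
    using u L_s by (simp add: algebra_simps)
  also have "\<dots> \<le> L y"
    using concave_onD[OF L_concave, of u x s] u x L_s y by simp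
  finally show "L x < L y" .
qed

text \<open>The preimage is found explicitly, by inverting the line on a segment whose values
  enclose \<open>y\<close>.\<close>

lemma L_surj:
  assumes "y \<in> {0..1}"
  obtains x where "x \<in> {0..s}" "L x = y"
proof -
  obtain k where k: "k \<in> {1..CARD('d)}" "R (k - 1) \<le> y" "y \<le> R k"
    using ex_segment[of "CARD('d)" R y] assms by (auto simp: partial_sum_0 partial_sum_card sum_r)
  text \<open>If \<open>slope k = 0\<close>, the quotient is 0 and \<open>y\<close> equals \<open>R (k - 1)\<close>.\<close>
  define x where "x = t (k - 1) + (y - R (k - 1)) / slope k"
  have "0 \<le> (y - R (k - 1)) / slope k"
    using k r_nonneg[of "\<pi> k"] g_pos[of "\<pi> k"] by simp
  moreover have "(y - R (k - 1)) / slope k \<le> g $ \<pi> k"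
    using k r_nonneg[of "\<pi> k"] g_pos[of "\<pi> k"] partial_sum_step[OF k(1), of r]
    by (cases "r $ \<pi> k = 0") (auto simp: divide_simps)
  ultimately have x: "t (k - 1) \<le> x" "x \<le> t k"
    using partial_sum_step[OF k(1), of g] by (auto simp: x_def)
  have "x - t (k - 1) = (y - R (k - 1)) / slope k"
    by (simp add: x_def)
  then have "L x = R (k - 1) + slope k * ((y - R (k - 1)) / slope k)"
    using L_segment[OF k(1) x] by (simp only:)
  also have "\<dots> = y"
    using k g_pos[of "\<pi> k"] partial_sum_step[OF k(1), of r] by (cases "r $ \<pi> k = 0") auto
  finally have Lx: "L x = y" .
  have "k - 1 \<le> CARD('d)" using k by auto
  then have x01: "x \<in> {0..1}"
    using x k t_mono[of 0 "k - 1"] t_mono[of k "CARD('d)"] by (auto simp: partial_sum_0 partial_sum_card sum_g)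
  show ?thesis
  proof (cases "x \<le> s")
    case True
    then show ?thesis using that Lx x01 by auto
  next
    \<comment> \<open>Beyond \<open>s\<close> the curve is constantly 1, so \<open>y = 1\<close> and
      \<open>s\<close> itself is a preimage.\<close>
    case False
    then show ?thesis using that[of s] L_eq_1[of x] Lx x01 L_s by auto
  qed
qed

end

section \<open>Tests and their diagonals\<close>

text \<open>The quadratic form at the unit vector \<open>axis i 1\<close> is the diagonal
  entry.\<close>

lemma psd_diagonal:
  assumes "psd A" shows "0 \<le> Re (A $ i $ i)"
proof -
  have "cinner (axis i 1) (A *v axis i 1) = A $ i $ i"
    by (simp add: cinner_def matrix_vector_mult_def axis_def if_distrib if_distribR
        sum.delta sum.delta' cong: if_cong)
  then show ?thesis using assms by (metis psd_def)
qed

text \<open>The quadratic form is a sum of squared moduli weighted by \<open>p\<close>.\<close>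

lemma psd_diag_density:
  assumes "\<And>i. 0 \<le> p $ i" shows "psd (diag_density p)"
proof -
  have "(diag_density p *v x) $ i = complex_of_real (p $ i) * x $ i" for x i
    by (simp add: matrix_vector_mult_def diag_density_def if_distrib[of "\<lambda>c. c * _"] cong: if_cong)
  then have "cinner x (diag_density p *v x) = (\<Sum>i\<in>UNIV. complex_of_real (p $ i * (cmod (x $ i))\<^sup>2))" for x
    by (simp add: cinner_def complex_norm_square mult_ac del: of_real_power)
  then show ?thesis
    using assms by (auto simp: psd_def hermitian_def diag_density_def intro!: sum_nonneg)
qed

lemma Re_trace_mult_diag_density:
  "Re (trace (Q ** diag_density p)) = (\<chi> i. Re (Q $ i $ i)) \<bullet> p"
  by (simp add: trace_def matrix_matrix_mult_def diag_density_def inner_vec_def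
      if_distrib sum.delta sum.delta' cong: if_cong)

text \<open>One direction takes the diagonal of \<open>Q\<close>, the other the diagonal matrix of
  \<open>q\<close>; the minimization thus moves to the unit cube.\<close>

lemma ex_test_iff:
  "(\<exists>Q. loewner_le 0 Q \<and> loewner_le Q (mat 1) \<and>
      1 - \<epsilon> \<le> Re (trace (Q ** diag_density r)) \<and> x = Re (trace (Q ** diag_density g))) \<longleftrightarrow>
    (\<exists>q\<in>cbox 0 1. 1 - \<epsilon> \<le> q \<bullet> r \<and> x = q \<bullet> g)" (is "?L \<longleftrightarrow> ?R")
proof
  assume ?L
  then obtain Q where Q: "loewner_le 0 Q" "loewner_le Q (mat 1)"
    "1 - \<epsilon> \<le> Re (trace (Q ** diag_density r))" "x = Re (trace (Q ** diag_density g))" by blast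
  have "(\<chi> i. Re (Q $ i $ i)) \<in> cbox 0 1"
    using psd_diagonal[of Q] psd_diagonal[of "mat 1 - Q"] Q(1,2)
    by (simp add: loewner_le_def mem_box_cart mat_def)
  then show ?R using Q(3,4) unfolding Re_trace_mult_diag_density by blast
next
  assume ?R
  then obtain q where q: "q \<in> cbox 0 1" "1 - \<epsilon> \<le> q \<bullet> r" "x = q \<bullet> g" by blast
  have "mat 1 - diag_density q = diag_density (1 - q)"
    by (simp add: mat_def diag_density_def vec_eq_iff)
  then have "loewner_le 0 (diag_density q)" "loewner_le (diag_density q) (mat 1)"
    using q(1) by (auto simp: loewner_le_def mem_box_cart intro!: psd_diag_density)
  moreover have "Re (trace (diag_density q ** diag_density p)) = q \<bullet> p" for p
    unfolding Re_trace_mult_diag_density by (simp add: diag_density_def)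
  ultimately show ?L using q by metis
qed

lemma (in lorenz) type_II_error_complement_L:
  assumes x: "x \<in> {0..s}"
  shows "type_II_error (1 - L x) (diag_density r) (diag_density g) = x"
  unfolding type_II_error_def ex_test_iff
proof (rule Least_equality)
  have "x \<in> {0..1}" using x L_s by auto
  then show "\<exists>q\<in>cbox 0 1. 1 - (1 - L x) \<le> q \<bullet> r \<and> x = q \<bullet> g"
    by (metis L_attained diff_diff_eq2 add_diff_cancel_left' order_refl)
next
  fix y assume "\<exists>q\<in>cbox 0 1. 1 - (1 - L x) \<le> q \<bullet> r \<and> y = q \<bullet> g"
  then obtain q where q: "q \<in> cbox 0 1" "L x \<le> q \<bullet> r" "y = q \<bullet> g" by auto
  then have "L x \<le> L y" using inner_le_L[of q] by simp
  moreover have "0 \<le> y" using inner_in_unit[OF q(1) g] q by simp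
  \<comment> \<open>If \<open>y < x\<close>, both points lie in \<open>{0..s}\<close>, and strict
    monotonicity contradicts \<open>L x \<le> L y\<close>.\<close>
  ultimately show "x \<le> y"
    using strict_mono_onD[OF L_strict_mono, of y x] x by force
qed

section \<open>The equilibrium state and the inverse of \<open>b\<close>\<close>

lemma equilibrium_vector_pos: "0 < equilibrium_vector \<beta> \<mu> E n $ i"
  by (simp add: equilibrium_vector_def partition_function_def sum_pos)

lemma prob_vector_equilibrium_vector: "prob_vector (equilibrium_vector \<beta> \<mu> E n)"
proof -
  have "partition_function \<beta> \<mu> E n > 0"
    by (simp add: partition_function_def sum_pos)
  then show ?thesis
    using equilibrium_vector_pos[of \<beta> \<mu> E n]
    by (simp add: prob_vector_def less_imp_le)
      (simp add: equilibrium_vector_def partition_function_def flip: sum_divide_distrib)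
qed

text \<open>Accepting the whole support of \<open>r\<close> costs \<open>s = b 0\<close>, the
  largest value of \<open>b\<close>, so the inverse lives on \<open>{0..s}\<close>. If
  \<open>r\<close> has zero entries, then \<open>s < 1\<close>, and \<open>1 - L\<close> continues
  beyond \<open>s\<close> as 0. Full support gives the inverse on all of
  \<open>{0..1}\<close>.\<close>

theorem lemma4:
  fixes \<beta> \<mu> :: real
    and r E n g :: "real ^ 'd"
    and H N :: "complex ^ 'd ^ 'd"
    and e :: "'d \<Rightarrow> complex ^ 'd"
    and \<pi> :: "nat \<Rightarrow> 'd"
    and b L :: "real \<Rightarrow> real"
    and t :: "nat \<Rightarrow> real"
    and s :: real
  assumes "gp_state r H N e E n"
    and "g = equilibrium_vector \<beta> \<mu> E n"
    and "rescaled_order r g \<pi>"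
    and "t = partial_sum g \<pi>"
    and "L = lorenz_curve r g \<pi>"
    and "b = (\<lambda>\<epsilon>. type_II_error \<epsilon> (diag_density r) (diag_density g))"
    and "s = (\<Sum>i | r $ i \<noteq> 0. g $ i)"
  shows "bij_betw b {0..1} {0..s} \<and>
    (\<forall>x\<in>{0..s}. the_inv_into {0..1} b x
        = piecewise_linear t (\<lambda>k. 1 - L (t k)) CARD('d) x) \<and>
    (\<forall>x\<in>{s..1}. piecewise_linear t (\<lambda>k. 1 - L (t k)) CARD('d) x = 0) \<and>
    (\<forall>k\<le>CARD('d). t k \<le> s \<longrightarrow>
        (\<exists>\<epsilon>\<in>{0..1}. (t k, 1 - L (t k)) = (b \<epsilon>, \<epsilon>))) \<and>
    ((\<forall>i. r $ i \<noteq> 0) \<longrightarrow> s = 1)"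
proof -
  interpret lorenz r g \<pi>
    using assms(1-3) equilibrium_vector_pos prob_vector_equilibrium_vector
    by unfold_locales (auto simp: gp_state_def)
  have s1: "s \<in> {0..1}" and Ls: "\<And>x. x \<in> {s..1} \<Longrightarrow> L x = 1"
    using L_s L_eq_1 assms(5,7) by auto
  have L01: "\<And>x. x \<in> {0..1} \<Longrightarrow> L x \<in> {0..1}"
    using L_in_unit assms(5) by simp
  have pl: "\<And>x. x \<in> {0..1} \<Longrightarrow> piecewise_linear t (\<lambda>k. 1 - L (t k)) CARD('d) x = 1 - L x"
    using piecewise_linear_complement assms(4,5) by simp
  have bL: "\<And>x. x \<in> {0..s} \<Longrightarrow> b (1 - L x) = x"
    using type_II_error_complement_L assms(5-7) by simp
  have L_surj': "\<exists>x\<in>{0..s}. L x = y" if "y \<in> {0..1}" for y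
    using L_surj[OF that] assms(5,7) by metis
  \<comment> \<open>Surjectivity writes \<open>\<epsilon>\<close> as \<open>1 - L x\<close>, and
    then \<open>b \<epsilon> = x\<close>.\<close>
  have b_in: "b \<epsilon> \<in> {0..s} \<and> 1 - L (b \<epsilon>) = \<epsilon>" if \<epsilon>: "\<epsilon> \<in> {0..1}" for \<epsilon>
  proof -
    have "1 - \<epsilon> \<in> {0..1}" using \<epsilon> by simp
    then obtain x where x: "x \<in> {0..s}" "L x = 1 - \<epsilon>" using L_surj' by blast
    then show ?thesis using bL[OF x(1)] by simp
  qed
  have L_in: "1 - L x \<in> {0..1}" if "x \<in> {0..s}" for x
    using L01[of x] that s1 by simp
  \<comment> \<open>The map \<open>1 - L x\<close> is a two-sided inverse of \<open>b\<close>
    between the two intervals.\<close>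
  have bij_b: "bij_betw b {0..1} {0..s}"
    by (rule bij_betw_byWitness[where f' = "\<lambda>x. 1 - L x"]) (use b_in bL L_in in blast)+
  moreover have "the_inv_into {0..1} b x = piecewise_linear t (\<lambda>k. 1 - L (t k)) CARD('d) x"
    if "x \<in> {0..s}" for x
    using the_inv_into_f_eq[OF bij_betw_imp_inj_on[OF bij_b] bL L_in] pl[of x] that s1 by simp
  moreover have "\<exists>\<epsilon>\<in>{0..1}. (t k, 1 - L (t k)) = (b \<epsilon>, \<epsilon>)" if "k \<le> CARD('d)" "t k \<le> s" for k
  proof -
    have "t k \<in> {0..s}"
      using that t_mono[of 0 k] assms(4) by (simp add: partial_sum_0)
    then show ?thesis using bL L_in by force
  qed
  moreover have "s = 1" if "\<forall>i. r $ i \<noteq> 0"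
    using that assms(7) g by (simp add: prob_vector_def)
  ultimately show ?thesis using pl Ls s1 by auto
qed

end
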